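(* Let $R$ be a Noetherian ring with a reduction relation $\Longrightarrow$ fulfilling (A1)–(A3), and let $k\ge 1$. If every ideal of $R$ has a finite weak Gröbner basis, then every submodule of $R^k$ has a finite weak Gröbner basis with respect to the reduction relation $\longrightarrow$ on $R^k$ induced by $\Longrightarrow$.
   Context: $R$ is an associative, not necessarily commutative ring with unit; "ideal" means two-sided ideal, $\mathrm{ideal}_R(B)$ is the ideal generated by $B$, and $R$ Noetherian means every ideal is finitely generated. A reduction relation on $R$ is a family of binary relations $\Longrightarrow_\beta$ on $R$, $\beta\in R$; for $B\subseteq R$ one has a relation $\Longrightarrow_B$, with reflexive transitive closure $\stackrel{*}{\Longrightarrow}_B$. Axioms: (A1) $\Longrightarrow_B=\bigcup_{\beta\in B}\Longrightarrow_\beta$, and $\Longrightarrow_B$ is terminating for every finite $B\subseteq R$. (A2) $\alpha\Longrightarrow_\beta\gamma$ implies $\alpha-\gamma\in\mathrm{ideal}_R(\{\beta\})$. (A3) $\alpha\Longrightarrow_\alpha 0$ for all $\alpha\in R\setminus\{0\}$. A subset $B\subseteq R$ is a weak Gröbner basis of $\mathfrak i=\mathrm{ideal}_R(B)$ if $\Longrightarrow_B$ is terminating and $\alpha\stackrel{*}{\Longrightarrow}_B 0$ for all $\alpha\in\mathfrak i$. Modules: $R^k$ is viewed with componentwise addition and with left and right multiplication by elements of $R$ (componentwise). A submodule is an additive subgroup closed under left and right multiplication by elements of $R$; $\langle S\rangle=\{\sum_i\sum_j\beta_{ij}\, a_i\,\beta_{ij}'\mid a_i\in S,\ \beta_{ij},\beta'_{ij}\in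 R\}$ (finite sums) is the submodule generated by $S$. Reduction on $R^k$: for $a=(\alpha_1,\dots,\alpha_k)$, $b=(\beta_1,\dots,\beta_k)$, $b$ reduces $a$ to $c$ (written $a\longrightarrow_b c$) at position $s$ if (a) $\beta_j=0$ for $1\le j<s$; (b) $\alpha_s\Longrightarrow_{\beta_s}\gamma_s$ with $\alpha_s=\gamma_s+\sum_{i=1}^n\delta_i\beta_s\delta_i'$ for some $\delta_i,\delta_i'\in R$; (c) $c=a-\sum_{i=1}^n\delta_i\, b\,\delta_i'$ in the components from $s$ on, i.e. $c=(\alpha_1,\dots,\alpha_{s-1},\gamma_s,\alpha_{s+1}-\sum_i\delta_i\beta_{s+1}\delta_i',\dots,\alpha_k-\sum_i\delta_i\beta_k\delta_i')$. $\longrightarrow_B=\bigcup_{b\in B}\longrightarrow_b$. A subset $B\subseteq R^k$ is a weak Gröbner basis of the submodule $\mathcal S=\langle B\rangle$ if $\longrightarrow_B$ is terminating and $a\stackrel{*}{\longrightarrow}_B 0$ for all $a\in\mathcal S$. *)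

theory Defs
  imports "HOL-Algebra.Algebra"
begin

definition terminating :: "('a \<times> 'a) set \<Rightarrow> bool"
  where "terminating r \<longleftrightarrow> \<not> (\<exists>f :: nat \<Rightarrow> 'a. \<forall>i. (f i, f (Suc i)) \<in> r)"

(* A family of reductions is encoded as red :: 'a => ('a * 'a) set, where
   (alpha, gamma) : red beta  means that beta reduces alpha to gamma in one step. *)
definition red_by :: "('a \<Rightarrow> ('a \<times> 'a) set) \<Rightarrow> 'a set \<Rightarrow> ('a \<times> 'a) set"
  where "red_by red B = (\<Union>\<beta>\<in>B. red \<beta>)"

(* That the relation of a set B is the union of the relations of its elements is not
   an assumption of the locale, since it is the definition of red_by. *)
locale reduction_ring = ring R for R (structure) +
  fixes red :: "'a \<Rightarrow> ('a \<times> 'a) set"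
  assumes red_rel: "\<beta> \<in> carrier R \<Longrightarrow> red \<beta> \<subseteq> carrier R \<times> carrier R"
    and A1: "\<lbrakk>B \<subseteq> carrier R; finite B\<rbrakk> \<Longrightarrow> terminating (red_by red B)"
    and A2: "\<lbrakk>\<beta> \<in> carrier R; (\<alpha>, \<gamma>) \<in> red \<beta>\<rbrakk> \<Longrightarrow> \<alpha> \<ominus> \<gamma> \<in> Idl {\<beta>}"
    and A3: "\<alpha> \<in> carrier R - {\<zero>} \<Longrightarrow> (\<alpha>, \<zero>) \<in> red \<alpha>"

definition weak_groebner_basis ::
    "('a, 'm) ring_scheme \<Rightarrow> ('a \<Rightarrow> ('a \<times> 'a) set) \<Rightarrow> 'a set \<Rightarrow> 'a set \<Rightarrow> bool"
  where "weak_groebner_basis R red B I \<longleftrightarrow>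
    B \<subseteq> carrier R \<and> I = Idl\<^bsub>R\<^esub> B \<and> terminating (red_by red B) \<and>
    (\<forall>\<alpha>\<in>I. (\<alpha>, \<zero>\<^bsub>R\<^esub>) \<in> (red_by red B)\<^sup>*)"

(* Elements of R^k are functions on {1..k}, extended by "undefined" outside {1..k}
   so that equality of functions is equality of vectors. *)
definition vec_group :: "('a, 'm) ring_scheme \<Rightarrow> nat \<Rightarrow> (nat \<Rightarrow> 'a) monoid"
  where "vec_group R k = product_group {1..k} (\<lambda>_. add_monoid R)"

definition vec_lmult :: "('a, 'm) ring_scheme \<Rightarrow> nat \<Rightarrow> 'a \<Rightarrow> (nat \<Rightarrow> 'a) \<Rightarrow> (nat \<Rightarrow> 'a)"
  where "vec_lmult R k r a = (\<lambda>s\<in>{1..k}. r \<otimes>\<^bsub>R\<^esub> a s)"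

definition vec_rmult :: "('a, 'm) ring_scheme \<Rightarrow> nat \<Rightarrow> (nat \<Rightarrow> 'a) \<Rightarrow> 'a \<Rightarrow> (nat \<Rightarrow> 'a)"
  where "vec_rmult R k a r = (\<lambda>s\<in>{1..k}. a s \<otimes>\<^bsub>R\<^esub> r)"

(* The library's "submodule" concerns one-sided modules over a commutative ring;
   here submodules are two-sided. *)
definition vec_submodule :: "('a, 'm) ring_scheme \<Rightarrow> nat \<Rightarrow> (nat \<Rightarrow> 'a) set \<Rightarrow> bool"
  where "vec_submodule R k S \<longleftrightarrow>
    subgroup S (vec_group R k) \<and>
    (\<forall>r\<in>carrier R. \<forall>a\<in>S. vec_lmult R k r a \<in> S \<and> vec_rmult R k a r \<in> S)"

definition vec_span :: "('a, 'm) ring_scheme \<Rightarrow> nat \<Rightarrow> (nat \<Rightarrow> 'a) set \<Rightarrow> (nat \<Rightarrow> 'a) set"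
  where "vec_span R k S =
    {(\<lambda>s\<in>{1..k}. \<Oplus>\<^bsub>R\<^esub> i\<in>{1..m}. \<Oplus>\<^bsub>R\<^esub> j\<in>{1..n i}. \<beta> i j \<otimes>\<^bsub>R\<^esub> a i s \<otimes>\<^bsub>R\<^esub> \<beta>' i j)
      | (m :: nat) (n :: nat \<Rightarrow> nat) (a :: nat \<Rightarrow> nat \<Rightarrow> 'a)
        (\<beta> :: nat \<Rightarrow> nat \<Rightarrow> 'a) (\<beta>' :: nat \<Rightarrow> nat \<Rightarrow> 'a).
      \<forall>i\<in>{1..m}. a i \<in> S \<and> (\<forall>j\<in>{1..n i}. \<beta> i j \<in> carrier R \<and> \<beta>' i j \<in> carrier R)}"

definition vec_reduces_at ::
    "('a, 'm) ring_scheme \<Rightarrow> ('a \<Rightarrow> ('a \<times> 'a) set) \<Rightarrow> nat \<Rightarrow> nat \<Rightarrow>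
      (nat \<Rightarrow> 'a) \<Rightarrow> (nat \<Rightarrow> 'a) \<Rightarrow> (nat \<Rightarrow> 'a) \<Rightarrow> bool"
  where "vec_reduces_at R red k s b a c \<longleftrightarrow>
    a \<in> carrier (vec_group R k) \<and> b \<in> carrier (vec_group R k) \<and> s \<in> {1..k} \<and>
    (\<forall>j\<in>{1..<s}. b j = \<zero>\<^bsub>R\<^esub>) \<and>
    (\<exists>\<gamma> (n :: nat) \<delta> \<delta>'.
      (\<forall>i\<in>{1..n}. \<delta> i \<in> carrier R \<and> \<delta>' i \<in> carrier R) \<and>
      (a s, \<gamma>) \<in> red (b s) \<and>
      a s = \<gamma> \<oplus>\<^bsub>R\<^esub> (\<Oplus>\<^bsub>R\<^esub> i\<in>{1..n}. \<delta> i \<otimes>\<^bsub>R\<^esub> b s \<otimes>\<^bsub>R\<^esub> \<delta>' i) \<and>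
      c = (\<lambda>j\<in>{1..k}.
        if j < s then a j
        else if j = s then \<gamma>
        else a j \<ominus>\<^bsub>R\<^esub> (\<Oplus>\<^bsub>R\<^esub> i\<in>{1..n}. \<delta> i \<otimes>\<^bsub>R\<^esub> b j \<otimes>\<^bsub>R\<^esub> \<delta>' i)))"

definition vec_red ::
    "('a, 'm) ring_scheme \<Rightarrow> ('a \<Rightarrow> ('a \<times> 'a) set) \<Rightarrow> nat \<Rightarrow>
      (nat \<Rightarrow> 'a) \<Rightarrow> ((nat \<Rightarrow> 'a) \<times> (nat \<Rightarrow> 'a)) set"
  where "vec_red R red k b = {(a, c). \<exists>s. vec_reduces_at R red k s b a c}"

definition vec_weak_groebner_basis ::
    "('a, 'm) ring_scheme \<Rightarrow> ('a \<Rightarrow> ('a \<times> 'a) set) \<Rightarrow> nat \<Rightarrow>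
      (nat \<Rightarrow> 'a) set \<Rightarrow> (nat \<Rightarrow> 'a) set \<Rightarrow> bool"
  where "vec_weak_groebner_basis R red k B S \<longleftrightarrow>
    B \<subseteq> carrier (vec_group R k) \<and> S = vec_span R k B \<and>
    terminating (red_by (vec_red R red k) B) \<and>
    (\<forall>a\<in>S. (a, \<lambda>s\<in>{1..k}. \<zero>\<^bsub>R\<^esub>) \<in> (red_by (vec_red R red k) B)\<^sup>*)"

end

theory Submission
  imports Defs
begin

text \<open>For a submodule \<open>S\<close> let \<open>S\<^sub>s\<close> be the set of its elements vanishing
  before position \<open>s\<close>. The \<open>s\<close>-th components of \<open>S\<^sub>s\<close> form an ideal; a
  finite weak Groebner basis of it is lifted to \<open>S\<^sub>s\<close>, and the union of these lifts over all \<open>s\<close>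
  is the required basis: by (A2), each reduction of the \<open>s\<close>-th component to \<open>\<zero>\<close> lifts to a
  reduction of vectors inside \<open>S\<^sub>s\<close>, which ends in \<open>S\<^bsub>s+1\<^esub>\<close>. Termination
  holds because a step at position \<open>s\<close> leaves the earlier components unchanged, so that the steps
  decrease the vector lexicographically.\<close>

section \<open>Termination as well-foundedness, and the additive group of vectors\<close>

text \<open>The converse is taken because \<open>wf\<close> puts the smaller element first, whereas
  a reduction step puts it second. In this form, lexicographic products and inverse images become
  available.\<close>

lemma terminating_iff_wf: "terminating r \<longleftrightarrow> wf (r\<inverse>)"
  by (simp add: terminating_def wf_iff_no_infinite_down_chain)

lemma carrier_vec_group: "carrier (vec_group R k) = {1..k} \<rightarrow>\<^sub>E carrier R"
  by (simp add: vec_group_def carrier_product_group)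

lemma one_vec_group: "\<one>\<^bsub>vec_group R k\<^esub> = (\<lambda>s\<in>{1..k}. \<zero>\<^bsub>R\<^esub>)"
  by (simp add: vec_group_def)

lemma mult_vec_group: "a \<otimes>\<^bsub>vec_group R k\<^esub> b = (\<lambda>s\<in>{1..k}. a s \<oplus>\<^bsub>R\<^esub> b s)"
  by (simp add: vec_group_def)

context ring
begin

lemma inv_vec_group:
  assumes "a \<in> carrier (vec_group R k)"
  shows "inv\<^bsub>vec_group R k\<^esub> a = (\<lambda>s\<in>{1..k}. \<ominus> a s)"
  using assms add.is_group unfolding vec_group_def
  by (subst inv_product_group) (auto simp: a_inv_def)

section \<open>The ideal generated by one element, with explicit coefficients\<close>

text \<open>This is the two-sided principal ideal of \<open>g\<close>. Without commutativity the
  single products \<open>u \<otimes> g \<otimes> v\<close> need not be closed under addition, hence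
  the finite sums. The indexing by \<open>{1..n}\<close> matches the witnesses demanded by
  \<open>vec_reduces_at\<close>.\<close>

definition singleton_sums :: "'a \<Rightarrow> 'a set"
  where "singleton_sums g = {\<Oplus>i\<in>{1..n}. \<delta> i \<otimes> g \<otimes> \<delta>' i | (n::nat) \<delta> \<delta>'.
    \<forall>i\<in>{1..n}. \<delta> i \<in> carrier R \<and> \<delta>' i \<in> carrier R}"

lemma singleton_sums_closed:
  assumes "g \<in> carrier R"
  shows "singleton_sums g \<subseteq> carrier R"
  using assms by (auto simp: singleton_sums_def intro!: finsum_closed)

lemma singleton_sums_add_term:
  assumes g: "g \<in> carrier R" and x: "x \<in> singleton_sums g"
    and uv: "u \<in> carrier R" "v \<in> carrier R"
  shows "x \<oplus> u \<otimes> g \<otimes> v \<in> singleton_sums g"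
proof -
  from x obtain n \<delta> \<delta>' where xeq: "x = (\<Oplus>i\<in>{1..n::nat}. \<delta> i \<otimes> g \<otimes> \<delta>' i)"
    and d: "\<forall>i\<in>{1..n}. \<delta> i \<in> carrier R \<and> \<delta>' i \<in> carrier R"
    by (auto simp: singleton_sums_def)
  let ?d = "\<delta>(Suc n := u)" and ?d' = "\<delta>'(Suc n := v)"
  have d': "\<forall>i\<in>{1..Suc n}. ?d i \<in> carrier R \<and> ?d' i \<in> carrier R"
    using d uv by (auto simp: le_Suc_eq)
  have "(\<Oplus>i\<in>{1..n}. ?d i \<otimes> g \<otimes> ?d' i) = x"
    unfolding xeq using d g by (intro finsum_cong') auto
  moreover have "(\<Oplus>i\<in>insert (Suc n) {1..n}. ?d i \<otimes> g \<otimes> ?d' i)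
      = ?d (Suc n) \<otimes> g \<otimes> ?d' (Suc n) \<oplus> (\<Oplus>i\<in>{1..n}. ?d i \<otimes> g \<otimes> ?d' i)"
    using d g uv by (intro finsum_insert) auto
  moreover have "x \<in> carrier R" using singleton_sums_closed[OF g] x by blast
  ultimately have "x \<oplus> u \<otimes> g \<otimes> v = (\<Oplus>i\<in>{1..Suc n}. ?d i \<otimes> g \<otimes> ?d' i)"
    using g uv by (simp add: atLeastAtMostSuc_conv a_comm)
  then show ?thesis unfolding singleton_sums_def using d' by blast
qed

lemma singleton_sums_zero: "\<zero> \<in> singleton_sums g"
proof -
  have "\<zero> = (\<Oplus>i\<in>{1..0::nat}. \<one> \<otimes> g \<otimes> \<one>)" by simp
  then show ?thesis unfolding singleton_sums_def by fastforce
qed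

text \<open>Splitting off the last summand gives an induction rule that hides the index sets, so
  that closure properties need to be checked for one summand at a time.\<close>

lemma singleton_sums_induct [consumes 2, case_names zero add]:
  assumes "x \<in> singleton_sums g" "g \<in> carrier R" "P \<zero>"
    and "\<And>x u v. x \<in> singleton_sums g \<Longrightarrow> P x \<Longrightarrow> u \<in> carrier R \<Longrightarrow> v \<in> carrier R \<Longrightarrow>
      P (x \<oplus> u \<otimes> g \<otimes> v)"
  shows "P x"
proof -
  have "P (\<Oplus>i\<in>{1..n}. \<delta> i \<otimes> g \<otimes> \<delta>' i)"
    if "\<forall>i\<in>{1..n::nat}. \<delta> i \<in> carrier R \<and> \<delta>' i \<in> carrier R" for n \<delta> \<delta>'
    using that
  proof (induction n)
    case 0
    then show ?case using assms by simp
  next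
    case (Suc n)
    let ?f = "\<lambda>i. \<delta> i \<otimes> g \<otimes> \<delta>' i"
    have d: "\<forall>i\<in>{1..n::nat}. \<delta> i \<in> carrier R \<and> \<delta>' i \<in> carrier R"
        "\<delta> (Suc n) \<in> carrier R" "\<delta>' (Suc n) \<in> carrier R"
      using Suc.prems by auto
    have s: "finsum R ?f {1..n} \<in> singleton_sums g"
      using d unfolding singleton_sums_def by blast
    have "finsum R ?f (insert (Suc n) {1..n}) = ?f (Suc n) \<oplus> finsum R ?f {1..n}"
      using d assms by (intro finsum_insert) auto
    also have "\<dots> = finsum R ?f {1..n} \<oplus> ?f (Suc n)"
      using s singleton_sums_closed assms d by (intro a_comm) auto
    finally have "finsum R ?f {1..Suc n} = finsum R ?f {1..n} \<oplus> ?f (Suc n)"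
      by (simp add: atLeastAtMostSuc_conv)
    moreover have "P (finsum R ?f {1..n} \<oplus> ?f (Suc n))"
      using assms(4)[OF s] Suc.IH d by blast
    ultimately show ?case by simp
  qed
  then show ?thesis using assms(1) unfolding singleton_sums_def by blast
qed

lemma singleton_sums_add:
  assumes "y \<in> singleton_sums g" "g \<in> carrier R" "x \<in> singleton_sums g"
  shows "x \<oplus> y \<in> singleton_sums g"
  using assms
proof (induction rule: singleton_sums_induct)
  case zero
  then show ?case using singleton_sums_closed assms(2) by (metis r_zero subsetD)
next
  case (add y u v)
  then have "(x \<oplus> y) \<oplus> u \<otimes> g \<otimes> v \<in> singleton_sums g"
    using singleton_sums_add_term assms by blast
  then show ?case
    using add assms singleton_sums_closed[of g] by (simp add: a_assoc subset_iff)
qed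

text \<open>Each operation passes through the sum summand by summand: a sign or a left factor is
  absorbed by \<open>u\<close>, a right factor by \<open>v\<close>.\<close>

lemma ideal_singleton_sums:
  assumes g: "g \<in> carrier R"
  shows "ideal (singleton_sums g) R"
proof (rule idealI)
  note c = subsetD[OF singleton_sums_closed[OF g]]
  note add = singleton_sums_add_term[OF g]
  show "ring R" by (rule ring_axioms)
  show "subgroup (singleton_sums g) (add_monoid R)"
  proof (rule group.subgroupI[OF add.is_group])
    show "singleton_sums g \<subseteq> carrier (add_monoid R)"
      using singleton_sums_closed[OF g] by simp
    show "singleton_sums g \<noteq> {}" using singleton_sums_zero by blast
    show "x \<otimes>\<^bsub>add_monoid R\<^esub> y \<in> singleton_sums g"
      if "x \<in> singleton_sums g" "y \<in> singleton_sums g" for x y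
      using singleton_sums_add that g by simp
    show "inv\<^bsub>add_monoid R\<^esub> x \<in> singleton_sums g" if "x \<in> singleton_sums g" for x
      using that g
    proof (induction rule: singleton_sums_induct)
      case zero
      then show ?case using singleton_sums_zero minus_zero by (simp add: a_inv_def)
    next
      case (add x u v)
      then have "\<ominus> x \<oplus> (\<ominus> u) \<otimes> g \<otimes> v \<in> singleton_sums g"
        by (intro singleton_sums_add_term) (auto simp: a_inv_def[symmetric] g)
      moreover have "\<ominus> (x \<oplus> u \<otimes> g \<otimes> v) = \<ominus> x \<oplus> (\<ominus> u) \<otimes> g \<otimes> v"
        using add g c by (simp add: minus_add l_minus)
      ultimately show ?case by (simp add: a_inv_def)
    qed
  qed
  show "r \<otimes> x \<in> singleton_sums g" if "x \<in> singleton_sums g" "r \<in> carrier R" for x r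
    using that(1) g
  proof (induction rule: singleton_sums_induct)
    case zero
    then show ?case using that singleton_sums_zero by simp
  next
    case (add x u v)
    then have "r \<otimes> x \<oplus> (r \<otimes> u) \<otimes> g \<otimes> v \<in> singleton_sums g"
      using that g by (intro singleton_sums_add_term) auto
    then show ?case using add that g c by (simp add: r_distr m_assoc)
  qed
  show "x \<otimes> r \<in> singleton_sums g" if "x \<in> singleton_sums g" "r \<in> carrier R" for x r
    using that(1) g
  proof (induction rule: singleton_sums_induct)
    case zero
    then show ?case using that singleton_sums_zero by simp
  next
    case (add x u v)
    then have "x \<otimes> r \<oplus> u \<otimes> g \<otimes> (v \<otimes> r) \<in> singleton_sums g"
      using that g by (intro singleton_sums_add_term) auto
    then show ?case using add that g c by (simp add: l_distr m_assoc)
  qed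
qed

text \<open>This turns the ideal membership provided by \<open>A2\<close> into the coefficients that
  a reduction step on vectors has to exhibit.\<close>

lemma genideal_singleton_subset_sums:
  assumes "g \<in> carrier R"
  shows "Idl {g} \<subseteq> singleton_sums g"
proof (rule genideal_minimal[OF ideal_singleton_sums[OF assms]])
  have "\<zero> \<oplus> \<one> \<otimes> g \<otimes> \<one> \<in> singleton_sums g"
    using singleton_sums_add_term singleton_sums_zero assms by blast
  then show "{g} \<subseteq> singleton_sums g" using assms by simp
qed

section \<open>Submodules, spans and their behaviour under reduction\<close>

lemma vec_submodule_finsum:
  assumes S: "vec_submodule R k S"
    and "\<forall>i\<in>{1..m::nat}. v i \<in> S"
  shows "(\<lambda>s\<in>{1..k}. \<Oplus>i\<in>{1..m}. v i s) \<in> S"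
  using assms(2)
proof (induction m)
  case 0
  then show ?case
    using S subgroup.one_closed[of S "vec_group R k"]
    by (simp add: vec_submodule_def one_vec_group restrict_def)
next
  case (Suc m)
  have c: "v i s \<in> carrier R" if "i \<in> {1..Suc m}" "s \<in> {1..k}" for i s
    using S Suc.prems that subgroup.subset[of S "vec_group R k"]
    unfolding vec_submodule_def carrier_vec_group by blast
  have "v (Suc m) \<otimes>\<^bsub>vec_group R k\<^esub> (\<lambda>s\<in>{1..k}. \<Oplus>i\<in>{1..m}. v i s) \<in> S"
    using S Suc.prems by (intro subgroup.m_closed[OF _ _ Suc.IH]) (simp_all add: vec_submodule_def)
  also have "v (Suc m) \<otimes>\<^bsub>vec_group R k\<^esub> (\<lambda>s\<in>{1..k}. \<Oplus>i\<in>{1..m}. v i s)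
      = (\<lambda>s\<in>{1..k}. \<Oplus>i\<in>{1..Suc m}. v i s)"
  proof (unfold mult_vec_group, rule restrict_ext)
    fix s assume s: "s \<in> {1..k}"
    have "(\<Oplus>i\<in>insert (Suc m) {1..m}. v i s) = v (Suc m) s \<oplus> (\<Oplus>i\<in>{1..m}. v i s)"
      using c s by (intro finsum_insert) auto
    then show "v (Suc m) s \<oplus> (\<lambda>s\<in>{1..k}. \<Oplus>i\<in>{1..m}. v i s) s = (\<Oplus>i\<in>{1..Suc m}. v i s)"
      using s by (simp add: atLeastAtMostSuc_conv)
  qed
  finally show ?case .
qed

text \<open>Every summand is a right multiple of a left multiple of \<open>b\<close>. Such vectors
  are the inner sums of a span and also the vectors subtracted in reduction steps.\<close>

lemma vec_submodule_sandwich_sum: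
  assumes S: "vec_submodule R k S" and b: "b \<in> S"
    and d: "\<forall>i\<in>{1..n::nat}. \<delta> i \<in> carrier R \<and> \<delta>' i \<in> carrier R"
  shows "(\<lambda>s\<in>{1..k}. \<Oplus>i\<in>{1..n}. \<delta> i \<otimes> b s \<otimes> \<delta>' i) \<in> S"
proof -
  let ?v = "\<lambda>i. vec_rmult R k (vec_lmult R k (\<delta> i) b) (\<delta>' i)"
  have bc: "b s \<in> carrier R" if "s \<in> {1..k}" for s
    using S b that subgroup.subset[of S "vec_group R k"]
    unfolding vec_submodule_def carrier_vec_group by blast
  have "(\<lambda>s\<in>{1..k}. \<Oplus>i\<in>{1..n}. ?v i s) \<in> S"
    using S b d by (intro vec_submodule_finsum) (auto simp: vec_submodule_def)
  also have "(\<lambda>s\<in>{1..k}. \<Oplus>i\<in>{1..n}. ?v i s) = (\<lambda>s\<in>{1..k}. \<Oplus>i\<in>{1..n}. \<delta> i \<otimes> b s \<otimes> \<delta>' i)"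
    using d bc by (intro restrict_ext finsum_cong') (auto simp: vec_lmult_def vec_rmult_def)
  finally show ?thesis .
qed

lemma vec_span_subset_submodule:
  assumes S: "vec_submodule R k S" and B: "B \<subseteq> S"
  shows "vec_span R k B \<subseteq> S"
proof
  fix x assume "x \<in> vec_span R k B"
  then obtain m n a \<beta> \<beta>' where
    x: "x = (\<lambda>s\<in>{1..k}. \<Oplus>i\<in>{1..m::nat}. \<Oplus>j\<in>{1..n i::nat}. \<beta> i j \<otimes> a i s \<otimes> \<beta>' i j)"
    and a: "\<forall>i\<in>{1..m}. a i \<in> B \<and> (\<forall>j\<in>{1..n i}. \<beta> i j \<in> carrier R \<and> \<beta>' i j \<in> carrier R)"
    unfolding vec_span_def by blast
  let ?v = "\<lambda>i. \<lambda>s\<in>{1..k}. \<Oplus>j\<in>{1..n i}. \<beta> i j \<otimes> a i s \<otimes> \<beta>' i j"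
  have v: "\<forall>i\<in>{1..m}. ?v i \<in> S"
    using a B by (intro ballI vec_submodule_sandwich_sum[OF S]) auto
  have "?v i s \<in> carrier R" if "i \<in> {1..m}" "s \<in> {1..k}" for i s
    using S v that subgroup.subset[of S "vec_group R k"]
    unfolding vec_submodule_def carrier_vec_group by blast
  then have "x = (\<lambda>s\<in>{1..k}. \<Oplus>i\<in>{1..m}. ?v i s)"
    unfolding x by (intro restrict_ext finsum_cong') auto
  with vec_submodule_finsum[OF S v] show "x \<in> S" by simp
qed

lemma vec_span_zero: "(\<lambda>s\<in>{1..k}. \<zero>) \<in> vec_span R k B"
proof -
  \<comment> \<open>The empty outer sum, \<open>m = 0\<close>, involves no generator, so
    \<open>B\<close> may be empty.\<close>
  have "(\<lambda>s\<in>{1..k}. \<zero>) = (\<lambda>s\<in>{1..k}. \<Oplus>i\<in>{1..0::nat}. \<Oplus>j\<in>{1..0::nat}. \<zero> \<otimes> \<zero> \<otimes> \<zero>)"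
    by simp
  then show ?thesis unfolding vec_span_def by fastforce
qed

text \<open>The new sum becomes one more outer block, with index \<open>Suc m\<close>. A whole sum
  is added at once because one reduction step subtracts a whole sum of multiples of
  \<open>b\<close>.\<close>

lemma vec_span_add_sandwich_sum:
  assumes B: "B \<subseteq> carrier (vec_group R k)" and c: "c \<in> vec_span R k B" and b: "b \<in> B"
    and d: "\<forall>i\<in>{1..l::nat}. \<delta> i \<in> carrier R \<and> \<delta>' i \<in> carrier R"
  shows "(\<lambda>s\<in>{1..k}. c s \<oplus> (\<Oplus>i\<in>{1..l}. \<delta> i \<otimes> b s \<otimes> \<delta>' i)) \<in> vec_span R k B"
proof -
  from c obtain m n a \<beta> \<beta>' where
    c: "c = (\<lambda>s\<in>{1..k}. \<Oplus>i\<in>{1..m::nat}. \<Oplus>j\<in>{1..n i::nat}. \<beta> i j \<otimes> a i s \<otimes> \<beta>' i j)"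
    and a: "\<forall>i\<in>{1..m}. a i \<in> B \<and> (\<forall>j\<in>{1..n i}. \<beta> i j \<in> carrier R \<and> \<beta>' i j \<in> carrier R)"
    unfolding vec_span_def by blast
  let ?n = "n(Suc m := l)" and ?a = "a(Suc m := b)"
    and ?\<beta> = "\<beta>(Suc m := \<delta>)" and ?\<beta>' = "\<beta>'(Suc m := \<delta>')"
  let ?f = "\<lambda>i s. \<Oplus>j\<in>{1..?n i}. ?\<beta> i j \<otimes> ?a i s \<otimes> ?\<beta>' i j"
  have a': "\<forall>i\<in>{1..Suc m}. ?a i \<in> B \<and>
      (\<forall>j\<in>{1..?n i}. ?\<beta> i j \<in> carrier R \<and> ?\<beta>' i j \<in> carrier R)"
    using a b d by (auto simp: le_Suc_eq)
  have f: "?f i s \<in> carrier R" if "i \<in> {1..Suc m}" "s \<in> {1..k}" for i s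
  proof (rule finsum_closed, rule funcsetI)
    fix j assume "j \<in> {1..?n i}"
    moreover have "?a i s \<in> carrier R"
      using a' that B unfolding carrier_vec_group by blast
    ultimately show "?\<beta> i j \<otimes> ?a i s \<otimes> ?\<beta>' i j \<in> carrier R"
      using a' that by blast
  qed
  have "(\<lambda>s\<in>{1..k}. c s \<oplus> (\<Oplus>i\<in>{1..l}. \<delta> i \<otimes> b s \<otimes> \<delta>' i))
      = (\<lambda>s\<in>{1..k}. \<Oplus>i\<in>{1..Suc m}. ?f i s)"
  proof (rule restrict_ext)
    fix s assume s: "s \<in> {1..k}"
    have fm: "(\<lambda>i. ?f i s) \<in> {1..m} \<rightarrow> carrier R" using f[OF _ s] by fastforce
    have "c s = (\<Oplus>i\<in>{1..m}. \<Oplus>j\<in>{1..n i}. \<beta> i j \<otimes> a i s \<otimes> \<beta>' i j)"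
      unfolding c using s by simp
    also have "\<dots> = (\<Oplus>i\<in>{1..m}. ?f i s)"
      using fm by (intro finsum_cong'[OF refl]) (simp_all only: fun_upd_apply, simp)
    finally have "c s = (\<Oplus>i\<in>{1..m}. ?f i s)" .
    moreover have "(\<Oplus>i\<in>insert (Suc m) {1..m}. ?f i s) = ?f (Suc m) s \<oplus> (\<Oplus>i\<in>{1..m}. ?f i s)"
      by (rule finsum_insert[OF _ _ fm f[OF _ s]]) auto
    moreover have "\<dots> = (\<Oplus>i\<in>{1..m}. ?f i s) \<oplus> ?f (Suc m) s"
      using f[of "Suc m" s] s finsum_closed[OF fm] by (intro a_comm) auto
    ultimately show "c s \<oplus> (\<Oplus>i\<in>{1..l}. \<delta> i \<otimes> b s \<otimes> \<delta>' i) = (\<Oplus>i\<in>{1..Suc m}. ?f i s)"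
      by (simp add: atLeastAtMostSuc_conv)
  qed
  then show ?thesis using a' unfolding vec_span_def by blast
qed

text \<open>The witnesses in the definition of a reduction step show that \<open>a - c\<close> is a sum of
  multiples of \<open>b\<close> in every component: before position \<open>s\<close> both sides vanish.\<close>

lemma vec_span_red_step:
  assumes B: "B \<subseteq> carrier (vec_group R k)" and c: "c \<in> vec_span R k B" and b: "b \<in> B"
    and ac: "(a, c) \<in> vec_red R red k b"
  shows "a \<in> vec_span R k B"
proof -
  obtain s \<gamma> n \<delta> \<delta>' where a: "a \<in> carrier (vec_group R k)" and bc: "b \<in> carrier (vec_group R k)"
    and s: "s \<in> {1..k}" and b0: "\<forall>j\<in>{1..<s}. b j = \<zero>"
    and d: "\<forall>i\<in>{1..n::nat}. \<delta> i \<in> carrier R \<and> \<delta>' i \<in> carrier R"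
    and as: "a s = \<gamma> \<oplus> (\<Oplus>i\<in>{1..n}. \<delta> i \<otimes> b s \<otimes> \<delta>' i)"
    and ceq: "c = (\<lambda>j\<in>{1..k}. if j < s then a j else if j = s then \<gamma>
        else a j \<ominus> (\<Oplus>i\<in>{1..n}. \<delta> i \<otimes> b j \<otimes> \<delta>' i))"
    using ac unfolding vec_red_def vec_reduces_at_def by blast
  have "a = (\<lambda>j\<in>{1..k}. c j \<oplus> (\<Oplus>i\<in>{1..n}. \<delta> i \<otimes> b j \<otimes> \<delta>' i))"
  proof (rule extensionalityI[of _ "{1..k}"])
    show "a \<in> extensional {1..k}" using a unfolding carrier_vec_group by (simp add: PiE_iff)
    fix j assume j: "j \<in> {1..k}"
    have aj: "a j \<in> carrier R" and bj: "b j \<in> carrier R"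
      using a bc j unfolding carrier_vec_group by auto
    have sum: "(\<Oplus>i\<in>{1..n}. \<delta> i \<otimes> b j \<otimes> \<delta>' i) \<in> carrier R"
      using d bj by (intro finsum_closed) auto
    have zero: "(\<Oplus>i\<in>{1..n}. \<delta> i \<otimes> b j \<otimes> \<delta>' i) = \<zero>" if "j < s"
    proof -
      have "(\<Oplus>i\<in>{1..n}. \<delta> i \<otimes> b j \<otimes> \<delta>' i) = (\<Oplus>i\<in>{1..n}. \<zero>)"
        using d b0 j that by (intro finsum_cong') auto
      then show ?thesis by simp
    qed
    have "a j = c j \<oplus> (\<Oplus>i\<in>{1..n}. \<delta> i \<otimes> b j \<otimes> \<delta>' i)"
    proof (cases j s rule: linorder_cases)
      case less
      then show ?thesis using zero[OF less] aj j by (simp add: ceq)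
    next
      case equal
      then show ?thesis using as j by (simp add: ceq)
    next
      case greater
      then have "c j = a j \<ominus> (\<Oplus>i\<in>{1..n}. \<delta> i \<otimes> b j \<otimes> \<delta>' i)"
        using j by (simp add: ceq)
      then show ?thesis using aj sum by (simp add: a_minus_def a_assoc l_neg)
    qed
    then show "a j = (\<lambda>j\<in>{1..k}. c j \<oplus> (\<Oplus>i\<in>{1..n}. \<delta> i \<otimes> b j \<otimes> \<delta>' i)) j" using j by simp
  qed (simp)
  then show ?thesis using vec_span_add_sandwich_sum[OF B c b d] by simp
qed

text \<open>Membership in the span is carried backwards along the chain. Applied to a chain ending
  in the zero vector, it shows that whatever reduces to zero is generated by
  \<open>B\<close>.\<close>

lemma vec_span_red_rtrancl:
  assumes B: "B \<subseteq> carrier (vec_group R k)"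
    and "(a, c) \<in> (red_by (vec_red R red k) B)\<^sup>*" "c \<in> vec_span R k B"
  shows "a \<in> vec_span R k B"
  using assms(2,3)
  by (induction rule: converse_rtrancl_induct)
    (auto simp: red_by_def intro: vec_span_red_step[OF B])

section \<open>Ideals of leading components\<close>

text \<open>Positions start at 1, so for \<open>s = 1\<close> the vanishing condition is empty and
  all vectors of \<open>S\<close> contribute. The component \<open>a s\<close> itself may be
  zero.\<close>

definition leading_comps :: "(nat \<Rightarrow> 'a) set \<Rightarrow> nat \<Rightarrow> 'a set"
  where "leading_comps S s = {a s | a. a \<in> S \<and> (\<forall>j\<in>{1..<s}. a j = \<zero>)}"

text \<open>All operations on vectors act componentwise and preserve vanishing before
  \<open>s\<close>, so each ideal operation is performed on the vectors that witness
  membership.\<close>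

lemma ideal_leading_comps:
  assumes S: "vec_submodule R k S" and s: "s \<in> {1..k}"
  shows "ideal (leading_comps S s) R"
proof (rule idealI)
  have sub: "subgroup S (vec_group R k)" using S by (simp add: vec_submodule_def)
  have Sc: "S \<subseteq> carrier (vec_group R k)" using sub by (rule subgroup.subset)
  have comp: "a j \<in> carrier R" if "a \<in> S" "j \<in> {1..k}" for a j
    using Sc that unfolding carrier_vec_group by blast
  have intro: "x \<in> leading_comps S s"
    if "a \<in> S" "\<And>j. j \<in> {1..<s} \<Longrightarrow> a j = \<zero>" "a s = x" for a x
    using that unfolding leading_comps_def by blast
  have js: "j \<in> {1..k}" if "j \<in> {1..<s}" for j using that s by auto
  show "ring R" by (rule ring_axioms)
  show "subgroup (leading_comps S s) (add_monoid R)"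
  proof (rule group.subgroupI[OF add.is_group])
    show "leading_comps S s \<subseteq> carrier (add_monoid R)"
      using comp s by (auto simp: leading_comps_def)
    have "\<zero> \<in> leading_comps S s"
      using subgroup.one_closed[OF sub] s
      by (intro intro[of "\<one>\<^bsub>vec_group R k\<^esub>"]) (auto simp: one_vec_group)
    then show "leading_comps S s \<noteq> {}" by blast
    fix x assume "x \<in> leading_comps S s"
    then obtain a where a: "a \<in> S" "\<forall>j\<in>{1..<s}. a j = \<zero>" "x = a s"
      by (auto simp: leading_comps_def)
    show "inv\<^bsub>add_monoid R\<^esub> x \<in> leading_comps S s"
      using subgroup.m_inv_closed[OF sub a(1)] a Sc s js
      by (intro intro[of "inv\<^bsub>vec_group R k\<^esub> a"]) (auto simp: inv_vec_group subset_iff a_inv_def[symmetric])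
    fix y assume "y \<in> leading_comps S s"
    then obtain b where b: "b \<in> S" "\<forall>j\<in>{1..<s}. b j = \<zero>" "y = b s"
      by (auto simp: leading_comps_def)
    show "x \<otimes>\<^bsub>add_monoid R\<^esub> y \<in> leading_comps S s"
      using subgroup.m_closed[OF sub a(1) b(1)] a b s js
      by (intro intro[of "a \<otimes>\<^bsub>vec_group R k\<^esub> b"]) (auto simp: mult_vec_group)
  qed
  fix x r assume "x \<in> leading_comps S s" and r: "r \<in> carrier R"
  then obtain a where a: "a \<in> S" "\<forall>j\<in>{1..<s}. a j = \<zero>" "x = a s"
    by (auto simp: leading_comps_def)
  show "r \<otimes> x \<in> leading_comps S s"
    using S a r s by (intro intro[of "vec_lmult R k r a"]) (auto simp: vec_submodule_def vec_lmult_def)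
  show "x \<otimes> r \<in> leading_comps S s"
    using S a r s by (intro intro[of "vec_rmult R k a r"]) (auto simp: vec_submodule_def vec_rmult_def)
qed

end

context reduction_ring
begin

section \<open>Termination of reduction on vectors\<close>

lemma terminating_vec_red:
  assumes B: "B \<subseteq> carrier (vec_group R k)" and fin: "finite B"
  shows "terminating (red_by (vec_red R red k) B)"
proof -
  \<comment> \<open>\<open>T t\<close> holds the inverted steps at positions beyond
    \<open>t\<close>. It is empty for \<open>t = k\<close> and covers all steps for
    \<open>t = 0\<close>, so well-foundedness is carried downwards from \<open>k\<close> to
    0.\<close>
  define T where "T t = {(c, a). \<exists>b\<in>B. \<exists>s>t. vec_reduces_at R red k s b a c}" for t
  have "wf (T 0)"
  proof (rule inc_induct[of 0 k])
    have "T k = {}" by (auto simp: T_def vec_reduces_at_def)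
    then show "wf (T k)" by simp
  next
    fix t assume t: "t < k" and IH: "wf (T (Suc t))"
    \<comment> \<open>All components of \<open>B\<close> at \<open>Suc t\<close> are collected, also
      those of vectors that do not vanish before that position. This enlargement is harmless, as
      \<open>A1\<close> asks only for a finite subset of the carrier.\<close>
    define C where "C = (\<lambda>b. b (Suc t)) ` B"
    have "C \<subseteq> carrier R"
      using B t unfolding C_def carrier_vec_group by (fastforce simp: PiE_iff)
    then have "wf ((red_by red C)\<inverse>)"
      using A1[of C] fin by (simp add: terminating_iff_wf C_def)
    then have "wf (inv_image ((red_by red C)\<inverse> <*lex*> T (Suc t)) (\<lambda>a. (a (Suc t), a)))"
      using IH by (intro wf_inv_image wf_lex_prod)
    \<comment> \<open>A step at \<open>Suc t\<close> decreases the first entry of the pair; a step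
      further right fixes that entry and lies in \<open>T (Suc t)\<close>.\<close>
    moreover have "T t \<subseteq> inv_image ((red_by red C)\<inverse> <*lex*> T (Suc t)) (\<lambda>a. (a (Suc t), a))"
    proof (rule subrelI)
      fix c a assume "(c, a) \<in> T t"
      then obtain b s where bs: "b \<in> B" "s > t" and r: "vec_reduces_at R red k s b a c"
        by (auto simp: T_def)
      show "(c, a) \<in> inv_image ((red_by red C)\<inverse> <*lex*> T (Suc t)) (\<lambda>a. (a (Suc t), a))"
      proof (cases "s = Suc t")
        case True
        then have "(a (Suc t), c (Suc t)) \<in> red (b (Suc t))"
          using r t by (auto simp: vec_reduces_at_def)
        then show ?thesis using bs by (auto simp: red_by_def C_def)
      next
        case False
        then have "s > Suc t" using bs by simp
        moreover from this have "c (Suc t) = a (Suc t)"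
          using r t by (auto simp: vec_reduces_at_def)
        ultimately show ?thesis using bs r by (auto simp: T_def)
      qed
    qed
    ultimately show "wf (T t)" by (rule wf_subset)
  qed simp
  moreover have "(red_by (vec_red R red k) B)\<inverse> \<subseteq> T 0"
  proof -
    have "s > 0" if "vec_reduces_at R red k s b a c" for s b a c
      using that by (simp add: vec_reduces_at_def)
    then show ?thesis unfolding T_def red_by_def vec_red_def by blast
  qed
  ultimately show ?thesis unfolding terminating_iff_wf by (rule wf_subset)
qed

section \<open>Lifting reductions from the ring to vectors\<close>

text \<open>By \<open>A2\<close>, \<open>a s \<ominus> \<gamma>\<close> is a sum of two-sided
  multiples of \<open>b s\<close>. Subtracting the same combination \<open>w\<close> of
  \<open>b\<close> from \<open>a\<close> stays in \<open>S\<close>, produces \<open>\<gamma>\<close>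
  at position \<open>s\<close>, and changes nothing before \<open>s\<close>, where \<open>b\<close>
  vanishes.\<close>

lemma vec_red_lift_step:
  assumes S: "vec_submodule R k S" and s: "s \<in> {1..k}"
    and a: "a \<in> S" "\<forall>j\<in>{1..<s}. a j = \<zero>"
    and b: "b \<in> S" "\<forall>j\<in>{1..<s}. b j = \<zero>"
    and red: "(a s, \<gamma>) \<in> red (b s)"
  shows "\<exists>c\<in>S. (\<forall>j\<in>{1..<s}. c j = \<zero>) \<and> c s = \<gamma> \<and> (a, c) \<in> vec_red R red k b"
proof -
  have sub: "subgroup S (vec_group R k)" using S by (simp add: vec_submodule_def)
  have Sc: "S \<subseteq> carrier (vec_group R k)" using sub by (rule subgroup.subset)
  have comp: "x j \<in> carrier R" if "x \<in> S" "j \<in> {1..k}" for x j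
    using Sc that unfolding carrier_vec_group by blast
  have bs: "b s \<in> carrier R" and as: "a s \<in> carrier R" using comp a b s by auto
  have g: "\<gamma> \<in> carrier R" using red_rel[OF bs] red by auto
  have "a s \<ominus> \<gamma> \<in> singleton_sums (b s)"
    using A2[OF bs red] genideal_singleton_subset_sums[OF bs] by blast
  then obtain n \<delta> \<delta>' where
    d: "\<forall>i\<in>{1..n::nat}. \<delta> i \<in> carrier R \<and> \<delta>' i \<in> carrier R"
    and eq: "a s \<ominus> \<gamma> = (\<Oplus>i\<in>{1..n}. \<delta> i \<otimes> b s \<otimes> \<delta>' i)"
    unfolding singleton_sums_def by blast
  define w where "w = (\<lambda>j\<in>{1..k}. \<Oplus>i\<in>{1..n}. \<delta> i \<otimes> b j \<otimes> \<delta>' i)"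
  have w: "w \<in> S" unfolding w_def by (rule vec_submodule_sandwich_sum[OF S b(1) d])
  \<comment> \<open>Defined through the group operations, \<open>c\<close> lies in \<open>S\<close>
    by subgroup closure; its componentwise form is derived afterwards.\<close>
  define c where "c = a \<otimes>\<^bsub>vec_group R k\<^esub> inv\<^bsub>vec_group R k\<^esub> w"
  have cS: "c \<in> S"
    unfolding c_def using sub a(1) w by (intro subgroup.m_closed subgroup.m_inv_closed)
  have cj: "c = (\<lambda>j\<in>{1..k}. a j \<ominus> w j)"
    unfolding c_def mult_vec_group using w Sc
    by (intro restrict_ext) (simp add: inv_vec_group subset_iff a_minus_def)
  have ws: "w s = a s \<ominus> \<gamma>" using eq s by (simp add: w_def)
  have cs: "c s = \<gamma>"
    using s as g by (simp add: cj ws a_minus_def minus_add a_assoc[symmetric] r_neg)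
  have wj: "w j = \<zero>" if "j \<in> {1..<s}" for j
  proof -
    have "(\<Oplus>i\<in>{1..n}. \<delta> i \<otimes> b j \<otimes> \<delta>' i) = (\<Oplus>i\<in>{1..n}. \<zero>)"
      using d b that by (intro finsum_cong') auto
    then show ?thesis using that s by (simp add: w_def)
  qed
  have c0: "c j = \<zero>" if "j \<in> {1..<s}" for j
    using wj[OF that] a that s by (simp add: cj a_minus_def)
  \<comment> \<open>Unfolding \<open>eq\<close> below rewrites the difference into the sum that
    \<open>vec_reduces_at\<close> requires.\<close>
  have "a s = \<gamma> \<oplus> (a s \<ominus> \<gamma>)"
    using as g by (simp add: a_minus_def a_lcomm[of \<gamma>] r_neg)
  moreover have "c = (\<lambda>j\<in>{1..k}. if j < s then a j else if j = s then \<gamma>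
      else a j \<ominus> (\<Oplus>i\<in>{1..n}. \<delta> i \<otimes> b j \<otimes> \<delta>' i))"
  proof (rule extensionalityI[of _ "{1..k}"])
    fix j assume j: "j \<in> {1..k}"
    show "c j = (\<lambda>j\<in>{1..k}. if j < s then a j else if j = s then \<gamma>
      else a j \<ominus> (\<Oplus>i\<in>{1..n}. \<delta> i \<otimes> b j \<otimes> \<delta>' i)) j"
      using j cs c0[of j] a by (cases j s rule: linorder_cases) (auto simp: cj w_def)
  qed (auto simp: cj)
  ultimately have "vec_reduces_at R red k s b a c"
    unfolding vec_reduces_at_def eq using a b s d red Sc
    by (intro conjI exI[of _ \<gamma>] exI[of _ n] exI[of _ \<delta>] exI[of _ \<delta>']) auto
  then show ?thesis using cS c0 cs unfolding vec_red_def by blast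
qed

text \<open>The chain is lifted step by step. Membership in \<open>S\<close> and vanishing before
  \<open>s\<close> are the invariants that allow the single-step lifting to be applied
  again.\<close>

lemma vec_red_lift:
  assumes S: "vec_submodule R k S" and s: "s \<in> {1..k}"
    and a: "a \<in> S" "\<forall>j\<in>{1..<s}. a j = \<zero>"
    and G: "\<forall>g\<in>G. \<exists>b\<in>B. b \<in> S \<and> (\<forall>j\<in>{1..<s}. b j = \<zero>) \<and> b s = g"
    and red: "(a s, \<gamma>) \<in> (red_by red G)\<^sup>*"
  shows "\<exists>c\<in>S. (\<forall>j\<in>{1..<s}. c j = \<zero>) \<and> c s = \<gamma> \<and> (a, c) \<in> (red_by (vec_red R red k) B)\<^sup>*"
  using red
proof (induction rule: rtrancl_induct)
  case base
  then show ?case using a by blast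
next
  case (step y z)
  then obtain c where c: "c \<in> S" "\<forall>j\<in>{1..<s}. c j = \<zero>" "c s = y"
    "(a, c) \<in> (red_by (vec_red R red k) B)\<^sup>*" by blast
  from step(2) obtain g where g: "g \<in> G" "(y, z) \<in> red g" by (auto simp: red_by_def)
  with G obtain b where b: "b \<in> B" "b \<in> S" "\<forall>j\<in>{1..<s}. b j = \<zero>" "b s = g" by blast
  from vec_red_lift_step[OF S s c(1,2) b(2,3), of z] g b c
  obtain d where d: "d \<in> S" "\<forall>j\<in>{1..<s}. d j = \<zero>" "d s = z" "(c, d) \<in> vec_red R red k b"
    by auto
  then have "(c, d) \<in> red_by (vec_red R red k) B" using b by (auto simp: red_by_def)
  with c(4) have "(a, d) \<in> (red_by (vec_red R red k) B)\<^sup>*"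
    by (rule rtrancl.rtrancl_into_rtrancl)
  then show ?case using d by blast
qed

text \<open>Components are cleared from left to right. Since the intermediate vector stays in
  \<open>S\<close>, its first component not yet cleared lies in the corresponding ideal and reduces
  to \<open>\<zero>\<close>.\<close>

lemma vec_red_to_zero:
  assumes S: "vec_submodule R k S" and a: "a \<in> S"
    and G: "\<And>s. s \<in> {1..k} \<Longrightarrow> weak_groebner_basis R red (G s) (leading_comps S s)"
    and B: "\<And>s g. \<lbrakk>s \<in> {1..k}; g \<in> G s\<rbrakk> \<Longrightarrow>
      \<exists>b\<in>B. b \<in> S \<and> (\<forall>j\<in>{1..<s}. b j = \<zero>) \<and> b s = g"
  shows "(a, \<lambda>s\<in>{1..k}. \<zero>) \<in> (red_by (vec_red R red k) B)\<^sup>*"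
proof -
  \<comment> \<open>Here \<open>t\<close> counts the cleared components: nothing is required for
    \<open>t = 0\<close>, and every component vanishes for \<open>t = k\<close>.\<close>
  have "\<exists>c\<in>S. (\<forall>j\<in>{1..<Suc t}. c j = \<zero>) \<and> (a, c) \<in> (red_by (vec_red R red k) B)\<^sup>*"
    if "t \<le> k" for t
    using that
  proof (induction t)
    case 0
    then show ?case using a by auto
  next
    case (Suc t)
    then obtain c where c: "c \<in> S" "\<forall>j\<in>{1..<Suc t}. c j = \<zero>"
      "(a, c) \<in> (red_by (vec_red R red k) B)\<^sup>*" by auto
    have s: "Suc t \<in> {1..k}" using Suc by simp
    have "c (Suc t) \<in> leading_comps S (Suc t)" using c unfolding leading_comps_def by blast
    then have "(c (Suc t), \<zero>) \<in> (red_by red (G (Suc t)))\<^sup>*"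
      using G[OF s] by (simp add: weak_groebner_basis_def)
    from vec_red_lift[OF S s c(1,2) _ this, of B] B[OF s]
    obtain d where d: "d \<in> S" "\<forall>j\<in>{1..<Suc t}. d j = \<zero>" "d (Suc t) = \<zero>"
      "(c, d) \<in> (red_by (vec_red R red k) B)\<^sup>*" by blast
    have "\<forall>j\<in>{1..<Suc (Suc t)}. d j = \<zero>" using d by (auto simp: less_Suc_eq)
    then show ?case using c d by (meson rtrancl_trans)
  qed
  from this[of k] obtain c where c: "c \<in> S" "\<forall>j\<in>{1..<Suc k}. c j = \<zero>"
    "(a, c) \<in> (red_by (vec_red R red k) B)\<^sup>*" by auto
  have "c \<in> {1..k} \<rightarrow>\<^sub>E carrier R"
    using S c subgroup.subset[of S "vec_group R k"]
    unfolding vec_submodule_def carrier_vec_group by blast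
  \<comment> \<open>Vectors are \<open>undefined\<close> outside \<open>{1..k}\<close>, so vanishing
    on \<open>{1..k}\<close> determines \<open>c\<close>.\<close>
  then have "c = (\<lambda>s\<in>{1..k}. \<zero>)"
    using c(2) by (intro extensionalityI[of _ "{1..k}"]) (auto simp: PiE_iff)
  with c show ?thesis by simp
qed

section \<open>Assembling the finite basis\<close>

lemma vec_weak_groebner_basis_exists:
  assumes gb: "\<And>I. ideal I R \<Longrightarrow> \<exists>B. finite B \<and> weak_groebner_basis R red B I"
    and S: "vec_submodule R k S"
  shows "\<exists>B. finite B \<and> vec_weak_groebner_basis R red k B S"
proof -
  have "\<forall>s\<in>{1..k}. \<exists>G. finite G \<and> weak_groebner_basis R red G (leading_comps S s)"
    using gb ideal_leading_comps[OF S] by blast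
  then obtain G where G: "\<And>s. s \<in> {1..k} \<Longrightarrow> finite (G s)"
      "\<And>s. s \<in> {1..k} \<Longrightarrow> weak_groebner_basis R red (G s) (leading_comps S s)"
    by metis
  \<comment> \<open>A basis lies in the ideal it generates, so each of its elements is the leading
    component of some vector of \<open>S\<close>; this supplies the lifts.\<close>
  have "G s \<subseteq> leading_comps S s" if "s \<in> {1..k}" for s
    using G(2)[OF that] genideal_self by (auto simp: weak_groebner_basis_def)
  then have "\<forall>s\<in>{1..k}. \<forall>g\<in>G s. \<exists>b. b \<in> S \<and> (\<forall>j\<in>{1..<s}. b j = \<zero>) \<and> b s = g"
    unfolding leading_comps_def by blast
  \<comment> \<open>The choice depends on \<open>s\<close> as well as on \<open>g\<close>, since the
    same ring element may occur in several \<open>G s\<close> and needs a lift for each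
    position.\<close>
  then obtain f where f: "\<And>s g. s \<in> {1..k} \<Longrightarrow> g \<in> G s \<Longrightarrow>
      f s g \<in> S \<and> (\<forall>j\<in>{1..<s}. f s g j = \<zero>) \<and> f s g s = g"
    by metis
  define B where "B = (\<Union>s\<in>{1..k}. f s ` G s)"
  have fin: "finite B" using G(1) by (auto simp: B_def)
  have BS: "B \<subseteq> S" using f by (auto simp: B_def)
  have Bc: "B \<subseteq> carrier (vec_group R k)"
    using BS S subgroup.subset[of S "vec_group R k"] by (auto simp: vec_submodule_def)
  have red0: "(a, \<lambda>s\<in>{1..k}. \<zero>) \<in> (red_by (vec_red R red k) B)\<^sup>*" if "a \<in> S" for a
  proof (rule vec_red_to_zero[OF S that G(2)])
    fix s g assume "s \<in> {1..k}" "g \<in> G s"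
    with f[OF this] show "\<exists>b\<in>B. b \<in> S \<and> (\<forall>j\<in>{1..<s}. b j = \<zero>) \<and> b s = g"
      unfolding B_def by blast
  qed
  \<comment> \<open>That \<open>B\<close> generates \<open>S\<close> is itself a consequence of
    reduction to zero; the other inclusion follows from \<open>B \<subseteq> S\<close>.\<close>
  have "S = vec_span R k B"
    using vec_span_subset_submodule[OF S BS] vec_span_red_rtrancl[OF Bc red0 vec_span_zero]
    by blast
  then have "vec_weak_groebner_basis R red k B S"
    unfolding vec_weak_groebner_basis_def
    using Bc terminating_vec_red[OF Bc fin] red0 by blast
  with fin show ?thesis by blast
qed

end

theorem theorem3p4p5:
  fixes R :: "('a, 'm) ring_scheme" and red :: "'a \<Rightarrow> ('a \<times> 'a) set" and k :: nat
  assumes "noetherian_ring R"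
    and "reduction_ring R red"
    and "1 \<le> k"
    and "\<forall>I. ideal I R \<longrightarrow> (\<exists>B. finite B \<and> weak_groebner_basis R red B I)"
  shows "\<forall>S. vec_submodule R k S \<longrightarrow>
    (\<exists>B. finite B \<and> vec_weak_groebner_basis R red k B S)"
  using reduction_ring.vec_weak_groebner_basis_exists[OF assms(2)] assms(4) by blast

end
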